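(* Let $0<\alpha<1$, let $t>0$ be fixed, and let $y\in C^2[0,t]$. For an integer $n\ge 3$ let $h=t/n$ and $y_k=y(kh)$. Then, as $n\to\infty$ (with $nh=t$), $$\frac{1}{\Gamma(1-\alpha)h^\alpha}\sum_{k=0}^{n} \sigma_k^{(\alpha)} y_{n-k}= y^{(\alpha)}(t)+O\left( h^{2-\alpha} \right),$$ where $$\sigma_0^{(\alpha)}=2^\alpha-\left(2^\alpha-1\right)\zeta(\alpha),\qquad \sigma_1^{(\alpha)}=\left(\tfrac{2}{3}\right)^\alpha-2^\alpha+\left(2^\alpha-1\right)\zeta(\alpha),$$ $$\sigma_{k}^{(\alpha)}=2^\alpha\left(\frac{1}{(2k+1)^\alpha}-\frac{1}{(2k-1)^\alpha}\right)\qquad (2\le k\le n-2),$$ $$\sigma_{n-1}^{(\alpha)}=\frac{2^\alpha}{(2n-1)^\alpha}-\frac{2^\alpha}{(2n-3)^\alpha}-\mathcal{W}_n,\qquad \sigma_{n}^{(\alpha)}=-\frac{2^\alpha}{(2n-1)^\alpha}+\mathcal{W}_n,$$ $$\mathcal{W}_n=\zeta(\alpha)-\frac{n^{1-\alpha}}{1-\alpha}+2^\alpha\left(\sum_{k=1}^{n}\frac{1}{(2k-1)^\alpha}-\zeta(\alpha)\right).$$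
   Context: $\zeta$ is the Riemann zeta function (analytically continued). The Caputo derivative of order $\alpha\in(0,1)$ is $y^{(\alpha)}(t)=\frac{1}{\Gamma(1-\alpha)}\int_0^t \frac{y'(x)}{(t-x)^\alpha}\,dx$. *)

theory Defs
  imports "HOL-Complex_Analysis.Complex_Analysis" "HOL-Library.Landau_Symbols"
begin

(* Value at s of the analytic continuation of sum_{n>=1} n^(-s) to a punctured half-plane
   {Re z > c} - {1} containing s.  By the identity theorem (see riemann_zeta_eqI) neither c nor f
   matters.  At the pole s = 1 the value is unspecified. *)
definition riemann_zeta :: "complex \<Rightarrow> complex" where
  "riemann_zeta s = (THE w. \<exists>c f. c < Re s \<and>
     f holomorphic_on ({z. c < Re z} - {1}) \<and>
     (\<forall>z. 1 < Re z \<longrightarrow> (\<lambda>n. of_nat (Suc n) powr (- z)) sums f z) \<and>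
     w = f s)"

lemma riemann_zeta_eqI:
  assumes s: "c < Re s" "s \<noteq> 1"
    and f: "f holomorphic_on ({z. c < Re z} - {1})"
    and sums: "\<And>z. 1 < Re z \<Longrightarrow> (\<lambda>n. of_nat (Suc n) powr (- z)) sums f z"
  shows "riemann_zeta s = f s"
  unfolding riemann_zeta_def
proof (rule the_equality)
  show "\<exists>c' f'. c' < Re s \<and> f' holomorphic_on ({z. c' < Re z} - {1}) \<and>
     (\<forall>z. 1 < Re z \<longrightarrow> (\<lambda>n. of_nat (Suc n) powr (- z)) sums f' z) \<and> f s = f' s"
    using assms by blast
next
  fix w
  assume "\<exists>d g. d < Re s \<and> g holomorphic_on ({z. d < Re z} - {1}) \<and>
     (\<forall>z. 1 < Re z \<longrightarrow> (\<lambda>n. of_nat (Suc n) powr (- z)) sums g z) \<and> w = g s"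
  then obtain d g where g: "d < Re s" "g holomorphic_on ({z. d < Re z} - {1})"
    "\<And>z. 1 < Re z \<Longrightarrow> (\<lambda>n. of_nat (Suc n) powr (- z)) sums g z" "w = g s"
    by blast
  define H where "H = {z::complex. max c d < Re z} - {1}"
  define U where "U = {z::complex. max (max c d) 1 < Re z}"
  have "f s = g s"
  proof (rule analytic_continuation_open[of U H f g])
    show "open U" unfolding U_def by (rule open_halfspace_Re_gt)
    show "open H" unfolding H_def by (intro open_delete open_halfspace_Re_gt)
    have "of_real (max (max c d) 1 + 1) \<in> U" unfolding U_def by (simp add: max_def)
    then show "U \<noteq> {}" by blast
    show "connected H" unfolding H_def
      by (intro connected_open_delete open_halfspace_Re_gt convex_connected
            convex_halfspace_Re_gt) simp
    show "U \<subseteq> H" unfolding U_def H_def by auto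
    show "f holomorphic_on H" by (rule holomorphic_on_subset[OF f]) (auto simp: H_def)
    show "g holomorphic_on H" by (rule holomorphic_on_subset[OF g(2)]) (auto simp: H_def)
    show "f z = g z" if "z \<in> U" for z
      using that sums[of z] g(3)[of z] sums_unique2 by (auto simp: U_def)
    show "s \<in> H" using s g(1) by (auto simp: H_def)
  qed
  with g(4) show "w = f s" by simp
qed

(* zeta is real on the real axis, so taking the real part loses nothing. *)
definition zeta_real :: "real \<Rightarrow> real" where
  "zeta_real a = Re (riemann_zeta (of_real a))"

(* Derivatives are taken within S, hence one-sided at the endpoints of an interval. *)
definition C2_on :: "real set \<Rightarrow> (real \<Rightarrow> real) \<Rightarrow> bool" where
  "C2_on S y \<longleftrightarrow> (\<exists>y' y''.
     (\<forall>x\<in>S. (y has_real_derivative y' x) (at x within S)) \<and>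
     (\<forall>x\<in>S. (y' has_real_derivative y'' x) (at x within S)) \<and>
     continuous_on S y'')"

definition caputo_deriv :: "real \<Rightarrow> (real \<Rightarrow> real) \<Rightarrow> real \<Rightarrow> real" where
  "caputo_deriv \<alpha> y t = 1 / Gamma (1 - \<alpha>) *
     integral {0..t} (\<lambda>x. vector_derivative y (at x within {0..t}) / (t - x) powr \<alpha>)"

definition W_corr :: "real \<Rightarrow> nat \<Rightarrow> real" where
  "W_corr \<alpha> n = zeta_real \<alpha> - real n powr (1 - \<alpha>) / (1 - \<alpha>)
     + 2 powr \<alpha> * ((\<Sum>k=1..n. 1 / (2 * real k - 1) powr \<alpha>) - zeta_real \<alpha>)"

(* Meaningful for n >= 3 and k <= n. *)
definition caputo_weight :: "real \<Rightarrow> nat \<Rightarrow> nat \<Rightarrow> real" where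
  "caputo_weight \<alpha> n k =
    (if k = 0 then 2 powr \<alpha> - (2 powr \<alpha> - 1) * zeta_real \<alpha>
     else if k = 1 then (2 / 3) powr \<alpha> - 2 powr \<alpha> + (2 powr \<alpha> - 1) * zeta_real \<alpha>
     else if k \<le> n - 2 then
       2 powr \<alpha> * (1 / (2 * real k + 1) powr \<alpha> - 1 / (2 * real k - 1) powr \<alpha>)
     else if k = n - 1 then
       2 powr \<alpha> / (2 * real n - 1) powr \<alpha> - 2 powr \<alpha> / (2 * real n - 3) powr \<alpha> - W_corr \<alpha> n
     else - (2 powr \<alpha> / (2 * real n - 1) powr \<alpha>) + W_corr \<alpha> n)"

end

(* After the substitution x = t - h s the Caputo integral becomes an integral of s^(-a) g(s) over
   [0,n] with g Lipschitz of constant O(h), and the scheme becomes the midpoint rule for the weight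
   s^(-a), applied to exact cell averages of g, plus two corrections at the ends.  The midpoint rule
   misses the integral of s^(-a) over [k,k+1] by e_k = O(k^(-a-2)), and the e_k sum to
   -(2^a - 1) zeta(a), the regularised value of -(sum of (k+1/2)^(-a)).  So the corrections make
   the scheme exact for constant g, with W_n the tail of the series of the e_k, and what
   remains is bounded by Lip(g) times sum (k+1) |e_k| and the telescoping total oscillation of
   s^(-a) over the cells. *)
theory Submission
  imports Defs
begin

section \<open>The zeta function in the critical strip\<close>

text \<open>The difference is the integral of \<open>x powr (-z)\<close> minus
  \<open>w powr (-z)\<close> for \<open>w\<close> from \<open>x\<close> to \<open>x + 1\<close>, and
  the derivative of \<open>w powr (-z)\<close> has norm at most the right-hand side there. The gain
  of one power of \<open>x\<close> is what carries convergence from \<open>Re z > 1\<close> to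
  \<open>Re z > 0\<close>.\<close>

lemma zeta_term_bound:
  fixes z :: complex and x :: real
  assumes z: "0 < Re z" "z \<noteq> 1" and x: "0 < x"
  shows "norm (of_real x powr (-z) - (of_real (x + 1) powr (1 - z) - of_real x powr (1 - z)) / (1 - z))
           \<le> norm z * x powr (- Re z - 1)"
proof -
  \<comment> \<open>The real segment inside the complex plane: convex, so the mean value inequality
    applies, and disjoint from the branch cut of \<open>powr\<close>.\<close>
  define S where "S = complex_of_real ` {x..x+1}"
  have conv: "convex S" unfolding S_def
    by (intro convex_linear_image) (auto intro!: bounded_linear.linear bounded_linear_of_real)
  have pos: "w \<notin> \<real>\<^sub>\<le>\<^sub>0" if "w \<in> S" for w
    using that x by (auto simp: S_def complex_nonpos_Reals_iff)
  have mem: "of_real x \<in> S" "of_real (x + 1) \<in> S" unfolding S_def by (intro imageI; simp)+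
  have one: "norm (w - of_real x) \<le> 1" if "w \<in> S" for w
  proof -
    obtain r where "w = of_real r" "x \<le> r" "r \<le> x + 1" using \<open>w \<in> S\<close> by (auto simp: S_def)
    moreover have "norm (complex_of_real r - of_real x) = \<bar>r - x\<bar>"
      by (metis norm_of_real of_real_diff)
    ultimately show ?thesis by simp
  qed
  define B where "B = norm z * x powr (- Re z - 1)"
  have B0: "0 \<le> B" by (simp add: B_def)
  have inner: "norm (of_real x powr (-z) - w powr (-z)) \<le> B" if w: "w \<in> S" for w
  proof -
    have "norm (of_real x powr (-z) - w powr (-z)) \<le> B * norm (of_real x - w)"
    proof (rule field_differentiable_bound[OF conv, where f = "\<lambda>w. w powr (-z)" and f' = "\<lambda>w. -z * w powr (-z - 1)"])
      fix v assume v: "v \<in> S"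
      show "((\<lambda>w. w powr (-z)) has_field_derivative -z * v powr (-z - 1)) (at v within S)"
        by (rule has_field_derivative_at_within, rule has_field_derivative_powr, rule pos, rule v)
      obtain r where r: "v = of_real r" "x \<le> r" using v by (auto simp: S_def)
      have "r powr (- Re z - 1) \<le> x powr (- Re z - 1)"
        using r x z by (intro powr_mono2') auto
      then show "norm (-z * v powr (-z - 1)) \<le> B"
        using r x by (simp add: B_def norm_mult norm_powr_real_powr mult_left_mono)
    qed (use mem w in auto)
    also have "\<dots> \<le> B * 1" using one[OF w] B0 by (intro mult_left_mono) (auto simp: norm_minus_commute)
    finally show ?thesis by simp
  qed
  \<comment> \<open>\<open>F\<close> has derivative
    \<open>of_real x powr (-z) - w powr (-z)\<close>, which \<open>inner\<close> bounds by
    \<open>B\<close>. A second mean value inequality on a segment of length 1 replaces the complex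
    integral.\<close>
  define F where "F = (\<lambda>w::complex. w * of_real x powr (-z) - w powr (1 - z) / (1 - z))"
  have "norm (F (of_real (x + 1)) - F (of_real x)) \<le> B * norm (complex_of_real (x + 1) - of_real x)"
  proof (rule field_differentiable_bound[OF conv, where f' = "\<lambda>w. of_real x powr (-z) - w powr (-z)"])
    fix v assume v: "v \<in> S"
    have "((\<lambda>w. w powr (1 - z)) has_field_derivative (1 - z) * v powr (1 - z - 1)) (at v within S)"
      by (rule has_field_derivative_at_within, rule has_field_derivative_powr, rule pos, rule v)
    from DERIV_cdivide[OF this, of "1 - z"] z(2)
    have "((\<lambda>w. w powr (1 - z) / (1 - z)) has_field_derivative v powr (-z)) (at v within S)"
      by simp
    then show "(F has_field_derivative of_real x powr (-z) - v powr (-z)) (at v within S)"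
      unfolding F_def by (intro DERIV_diff) (auto intro!: derivative_eq_intros)
  qed (use mem inner in auto)
  also have "F (of_real (x + 1)) - F (of_real x) =
     of_real x powr (-z) - (of_real (x + 1) powr (1 - z) - of_real x powr (1 - z)) / (1 - z)"
    by (simp add: F_def algebra_simps diff_divide_distrib)
  finally show ?thesis by (simp add: B_def)
qed

text \<open>The Dirichlet term at \<open>k + 1\<close> minus the integral of
  \<open>x powr (-z)\<close> over the interval from \<open>k + 1\<close> to \<open>k + 2\<close>, in
  a closed form that telescopes in \<open>k\<close>.\<close>

definition zeta_term :: "nat \<Rightarrow> complex \<Rightarrow> complex" where
  "zeta_term k z = of_nat (Suc k) powr (-z)
     - (of_nat (Suc (Suc k)) powr (1 - z) - of_nat (Suc k) powr (1 - z)) / (1 - z)"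

lemma norm_zeta_term_le:
  assumes "0 < Re z" "z \<noteq> 1"
  shows "norm (zeta_term k z) \<le> norm z * real (Suc k) powr (- Re z - 1)"
  using zeta_term_bound[OF assms, of "real (Suc k)"]
  unfolding zeta_term_def by (simp add: add.commute)

lemma summable_Suc_powr:
  assumes "0 < (c::real)"
  shows "summable (\<lambda>k. real (Suc k) powr (- c - 1))"
  by (subst summable_Suc_iff) (use assms in \<open>simp add: summable_real_powr_iff\<close>)

lemma summable_zeta_term:
  assumes "0 < Re z" "z \<noteq> 1"
  shows "summable (\<lambda>k. zeta_term k z)"
proof (rule summable_comparison_test')
  show "summable (\<lambda>k. norm z * real (Suc k) powr (- Re z - 1))"
    using assms by (intro summable_mult summable_Suc_powr)
  show "norm (zeta_term k z) \<le> norm z * real (Suc k) powr (- Re z - 1)" if "0 \<le> k" for k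
    by (rule norm_zeta_term_le[OF assms])
qed

text \<open>The lower limit 1 of the telescoped integrals leaves a surplus
  \<open>1 / (1 - z)\<close>; subtracting it recovers zeta and creates its pole at 1.\<close>

definition zeta_cont :: "complex \<Rightarrow> complex" where
  "zeta_cont z = (\<Sum>k. zeta_term k z) - 1 / (1 - z)"

lemma sum_zeta_term:
  assumes "z \<noteq> 1"
  shows "(\<Sum>k<N. zeta_term k z) - 1 / (1 - z)
    = (\<Sum>k<N. of_nat (Suc k) powr (-z)) - of_nat (Suc N) powr (1 - z) / (1 - z)"
proof (induction N)
  case (Suc N)
  have "(\<Sum>k<Suc N. zeta_term k z) - 1 / (1 - z) = zeta_term N z + ((\<Sum>k<N. zeta_term k z) - 1 / (1 - z))"
    by simp
  then show ?case unfolding Suc.IH by (simp add: zeta_term_def diff_divide_distrib)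
qed simp

lemma zeta_cont_tendsto:
  assumes "0 < Re z" "z \<noteq> 1"
  shows "(\<lambda>N. (\<Sum>k<N. of_nat (Suc k) powr (-z)) - of_nat (Suc N) powr (1 - z) / (1 - z))
           \<longlonglongrightarrow> zeta_cont z"
  unfolding sum_zeta_term[OF assms(2), symmetric] zeta_cont_def
  by (intro tendsto_intros summable_LIMSEQ summable_zeta_term assms)

lemma holomorphic_zeta_cont: "zeta_cont holomorphic_on ({z. 0 < Re z} - {1})"
proof -
  define S where "S = {z::complex. 0 < Re z} - {1}"
  have S: "open S" unfolding S_def by (intro open_delete open_halfspace_Re_gt)
  have "(\<lambda>z. \<Sum>k. zeta_term k z) holomorphic_on S"
  proof (rule holomorphic_uniform_sequence[OF S, where f = "\<lambda>N z. \<Sum>k<N. zeta_term k z"])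
    show "(\<lambda>z. \<Sum>k<N. zeta_term k z) holomorphic_on S" for N
      unfolding zeta_term_def by (intro holomorphic_intros) (auto simp: S_def simp flip: of_nat_Suc)
    fix w assume w: "w \<in> S"
    \<comment> \<open>On a disc where \<open>Re z\<close> exceeds half of \<open>Re w\<close>, all
      terms share the summable majorant with exponent \<open>- (Re w / 2) - 1\<close>, so
      convergence is locally uniform.\<close>
    then have "w \<in> S \<inter> {z. Re w / 2 < Re z}" by (auto simp: S_def)
    moreover have "open (S \<inter> {z. Re w / 2 < Re z})"
      by (intro open_Int S open_halfspace_Re_gt)
    ultimately obtain d where d: "d > 0" "cball w d \<subseteq> S \<inter> {z. Re w / 2 < Re z}"
      by (meson open_contains_cball)
    have "uniform_limit (cball w d) (\<lambda>N z. \<Sum>k<N. zeta_term k z) (\<lambda>z. \<Sum>k. zeta_term k z) sequentially"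
    proof (rule Weierstrass_m_test)
      show "summable (\<lambda>k. (norm w + d) * real (Suc k) powr (- (Re w / 2) - 1))"
        using w by (intro summable_mult summable_Suc_powr) (auto simp: S_def)
      fix k z assume z: "z \<in> cball w d"
      have "norm z \<le> norm w + d"
        using z norm_triangle_ineq2[of z w] by (auto simp: dist_norm norm_minus_commute)
      moreover have "real (Suc k) powr (- Re z - 1) \<le> real (Suc k) powr (- (Re w / 2) - 1)"
        using z d by (intro powr_mono) auto
      moreover have "norm (zeta_term k z) \<le> norm z * real (Suc k) powr (- Re z - 1)"
        using z d by (intro norm_zeta_term_le) (auto simp: S_def)
      ultimately show "norm (zeta_term k z) \<le> (norm w + d) * real (Suc k) powr (- (Re w / 2) - 1)"
        using d(1) by (smt (verit) mult_mono norm_ge_zero powr_ge_zero)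
    qed
    then show "\<exists>d>0. cball w d \<subseteq> S \<and>
        uniform_limit (cball w d) (\<lambda>N z. \<Sum>k<N. zeta_term k z) (\<lambda>z. \<Sum>k. zeta_term k z) sequentially"
      using d by blast
  qed
  then show ?thesis unfolding zeta_cont_def S_def by (intro holomorphic_intros) auto
qed

text \<open>The boundary term \<open>of_nat (Suc N) powr (1 - z) / (1 - z)\<close> tends to 0 as
  soon as \<open>Re z > 1\<close>, leaving the plain Dirichlet series.\<close>

lemma zeta_cont_sums:
  assumes "1 < Re z"
  shows "(\<lambda>n. of_nat (Suc n) powr (- z)) sums zeta_cont z"
proof -
  have z: "0 < Re z" "z \<noteq> 1" using assms by auto
  have "(\<lambda>N. real (Suc N) powr (1 - Re z)) \<longlonglongrightarrow> 0"
    using assms by (intro tendsto_neg_powr filterlim_compose[OF filterlim_real_sequentially filterlim_Suc]) auto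
  then have "(\<lambda>N. of_nat (Suc N) powr (1 - z)) \<longlonglongrightarrow> 0"
    by (rule Lim_transform_bound[rotated], intro always_eventually allI)
       (simp add: norm_powr_real_powr del: of_nat_Suc)
  then have "(\<lambda>N. of_nat (Suc N) powr (1 - z) / (1 - z)) \<longlonglongrightarrow> 0"
    by (intro tendsto_divide_zero)
  from tendsto_add[OF zeta_cont_tendsto[OF z] this] show ?thesis
    by (simp add: sums_def)
qed

lemma riemann_zeta_eq_zeta_cont:
  assumes "0 < Re z" "z \<noteq> 1"
  shows "riemann_zeta z = zeta_cont z"
  using assms holomorphic_zeta_cont zeta_cont_sums by (rule riemann_zeta_eqI)

text \<open>Real form of \<open>zeta_cont_tendsto\<close>, and the only analytic fact about zeta
  that the quadrature estimates draw on.\<close>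

lemma zeta_real_tendsto:
  assumes "0 < \<alpha>" "\<alpha> < 1"
  shows "(\<lambda>N. (\<Sum>k<N. real (Suc k) powr - \<alpha>) - real N powr (1 - \<alpha>) / (1 - \<alpha>)) \<longlonglongrightarrow> zeta_real \<alpha>"
proof -
  have z: "0 < Re (complex_of_real \<alpha>)" "complex_of_real \<alpha> \<noteq> 1"
    using assms by (auto simp: of_real_eq_1_iff)
  have eq: "(\<Sum>k<N. of_nat (Suc k) powr (- complex_of_real \<alpha>)) - of_nat (Suc N) powr (1 - complex_of_real \<alpha>) / (1 - complex_of_real \<alpha>)
     = complex_of_real ((\<Sum>k<N. real (Suc k) powr - \<alpha>) - real (Suc N) powr (1 - \<alpha>) / (1 - \<alpha>))" for N
  proof -
    have *: "of_nat (Suc k) powr complex_of_real b = complex_of_real (real (Suc k) powr b)" for k b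
      using powr_of_real[of "real (Suc k)" b] by (simp del: of_nat_Suc)
    show ?thesis using *[of _ "-\<alpha>"] *[of _ "1-\<alpha>"] by (simp del: of_nat_Suc)
  qed
  have A: "(\<lambda>N. (\<Sum>k<N. real (Suc k) powr - \<alpha>) - real (Suc N) powr (1 - \<alpha>) / (1 - \<alpha>)) \<longlonglongrightarrow> zeta_real \<alpha>"
    using tendsto_Re[OF zeta_cont_tendsto[OF z]] unfolding eq
    by (simp add: zeta_real_def riemann_zeta_eq_zeta_cont[OF z] del: of_nat_Suc)
  \<comment> \<open>\<open>A\<close> pairs the sum over \<open>k < N\<close> with the boundary at
    \<open>Suc N\<close>. Adding the vanishing term \<open>real (Suc N) powr - \<alpha>\<close>
    brings both to \<open>Suc N\<close>, and the index is then shifted down.\<close>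
  have "(\<lambda>N. real (Suc N) powr - \<alpha>) \<longlonglongrightarrow> 0"
    using assms by (intro tendsto_neg_powr filterlim_compose[OF filterlim_real_sequentially filterlim_Suc]) auto
  from tendsto_add[OF A this] show ?thesis
    by (subst filterlim_sequentially_Suc[symmetric]) (simp add: algebra_simps del: of_nat_Suc)
qed

section \<open>The defect of the midpoint rule\<close>

text \<open>The e_k of the overview. The closed form of the integral also holds in the singular cell
  \<open>k = 0\<close>, where \<open>0 powr (1 - \<alpha>)\<close> is 0.\<close>

definition midpoint_defect :: "real \<Rightarrow> nat \<Rightarrow> real" where
  "midpoint_defect \<alpha> k = ((real k + 1) powr (1 - \<alpha>) - real k powr (1 - \<alpha>)) / (1 - \<alpha>)
     - (real k + 1 / 2) powr - \<alpha>"

text \<open>Expand the antiderivative of \<open>x powr - \<alpha>\<close> around the midpoint to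
  third order at both ends of the cell. In the difference the even terms cancel, the linear ones
  give the midpoint value, and only third derivatives remain. Cell 0 is excluded because these blow
  up at 0.\<close>

lemma midpoint_defect_bound:
  assumes "0 < \<alpha>" "\<alpha> < 1" "1 \<le> k"
  shows "\<bar>midpoint_defect \<alpha> k\<bar> \<le> real k powr (- \<alpha> - 2)"
proof -
  define m where "m = real k + 1 / 2"
  \<comment> \<open>\<open>d 0\<close> is the antiderivative, and \<open>d 1\<close> to
    \<open>d 3\<close> are its successive derivatives, in the format that Taylor's theorem
    expects.\<close>
  define d where "d = (\<lambda>j::nat. \<lambda>x::real. if j = 0 then x powr (1 - \<alpha>) / (1 - \<alpha>)
     else if j = 1 then x powr - \<alpha> else if j = 2 then - \<alpha> * x powr (- \<alpha> - 1)
     else \<alpha> * (\<alpha> + 1) * x powr (- \<alpha> - 2))"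
  have d: "\<forall>j x. j < 3 \<and> real k \<le> x \<and> x \<le> real k + 1 \<longrightarrow> DERIV (d j) x :> d (Suc j) x"
  proof (intro allI impI)
    fix j :: nat and x :: real assume j: "j < 3 \<and> real k \<le> x \<and> x \<le> real k + 1"
    then have x: "0 < x" using assms by linarith
    consider "j = 0" | "j = 1" | "j = 2" using j by linarith
    then show "DERIV (d j) x :> d (Suc j) x"
    proof cases
      case 1
      have "((\<lambda>x. x powr (1 - \<alpha>) / (1 - \<alpha>)) has_real_derivative (1 - \<alpha>) * x powr (1 - \<alpha> - 1) / (1 - \<alpha>)) (at x)"
        by (intro DERIV_cdivide has_real_derivative_powr x)
      then show ?thesis using 1 assms unfolding d_def by simp
    next
      case 2
      then show ?thesis using x unfolding d_def
        by (auto intro!: derivative_eq_intros simp: field_simps)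
    next
      case 3
      have "((\<lambda>x. - \<alpha> * x powr (- \<alpha> - 1)) has_real_derivative - \<alpha> * ((- \<alpha> - 1) * x powr (- \<alpha> - 1 - 1))) (at x)"
        by (intro DERIV_cmult has_real_derivative_powr x)
      then show ?thesis using 3 unfolding d_def by (simp add: algebra_simps)
    qed
  qed
  obtain \<xi> where \<xi>: "m < \<xi>" "\<xi> < real k + 1"
    "d 0 (real k + 1) = (\<Sum>j<3. d j m / fact j * (real k + 1 - m) ^ j) + d 3 \<xi> / fact 3 * (real k + 1 - m) ^ 3"
    using Taylor_up[of 3 d "d 0" "real k" "real k + 1" m, OF _ refl d] by (auto simp: m_def)
  obtain \<eta> where \<eta>: "real k < \<eta>" "\<eta> < m"
    "d 0 (real k) = (\<Sum>j<3. d j m / fact j * (real k - m) ^ j) + d 3 \<eta> / fact 3 * (real k - m) ^ 3"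
    using Taylor_down[of 3 d "d 0" "real k" "real k + 1" m, OF _ refl d] by (auto simp: m_def)
  have "midpoint_defect \<alpha> k = d 0 (real k + 1) - d 0 (real k) - d 1 m"
    by (simp add: midpoint_defect_def d_def m_def diff_divide_distrib)
  \<comment> \<open>The factor 48 is \<open>fact 3\<close> times \<open>2 ^ 3\<close>, from the half
    cell width. The cube is negative at the left end, so the two remainders add.\<close>
  also have "\<dots> = (d 3 \<xi> + d 3 \<eta>) / 48"
    unfolding \<xi>(3) \<eta>(3) by (simp add: m_def numeral_3_eq_3 fact_numeral)
  finally have eq: "midpoint_defect \<alpha> k = (d 3 \<xi> + d 3 \<eta>) / 48" .
  have bound: "\<bar>d 3 x\<bar> \<le> 2 * real k powr (- \<alpha> - 2)" if "real k < x" for x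
  proof -
    have "\<alpha> * (\<alpha> + 1) \<le> 1 * 2" using assms by (intro mult_mono) auto
    moreover have "x powr (- \<alpha> - 2) \<le> real k powr (- \<alpha> - 2)"
      using that assms by (intro powr_mono2') auto
    ultimately have "\<alpha> * (\<alpha> + 1) * x powr (- \<alpha> - 2) \<le> 2 * real k powr (- \<alpha> - 2)"
      using assms by (intro mult_mono) auto
    then show ?thesis using assms by (simp add: d_def abs_mult)
  qed
  have "m > real k" by (simp add: m_def)
  then show ?thesis using bound[of \<xi>] bound[of \<eta>] \<xi> \<eta> unfolding eq by auto
qed

text \<open>The decay of order \<open>- \<alpha> - 2\<close> leaves room for one more factor
  \<open>k + 1\<close>. This weight is needed twice: for the drift of a Lipschitz function away from
  its value at 0, and for the tail estimate in \<open>W_corr_bound\<close>.\<close>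

lemma summable_midpoint_defect:
  assumes "0 < \<alpha>" "\<alpha> < 1"
  shows "summable (\<lambda>k. (real k + 1) * \<bar>midpoint_defect \<alpha> k\<bar>)"
proof (rule summable_comparison_test')
  show "summable (\<lambda>k. 2 * real k powr (- \<alpha> - 1))"
    using assms by (intro summable_mult) (simp add: summable_real_powr_iff)
  fix k :: nat assume k: "1 \<le> k"
  have "(real k + 1) * \<bar>midpoint_defect \<alpha> k\<bar> \<le> (2 * real k) * real k powr (- \<alpha> - 2)"
    using k by (intro mult_mono midpoint_defect_bound assms) auto
  also have "\<dots> = 2 * real k powr (- \<alpha> - 1)"
    using k powr_add[of "real k" 1 "- \<alpha> - 2"] by (simp add: minus_diff_commute)
  finally show "norm ((real k + 1) * \<bar>midpoint_defect \<alpha> k\<bar>) \<le> 2 * real k powr (- \<alpha> - 1)"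
    by simp
qed

lemma sum_midpoint_defect:
  assumes "0 < \<alpha>" "\<alpha> < 1"
  shows "(\<Sum>k<n. midpoint_defect \<alpha> k)
    = real n powr (1 - \<alpha>) / (1 - \<alpha>) - (\<Sum>k<n. (real k + 1 / 2) powr - \<alpha>)"
  using assms by (induction n) (auto simp: midpoint_defect_def diff_divide_distrib add.commute)

section \<open>The end correction W_n as the tail of the defect series\<close>

lemma powr_minus_add_half: "(real k + 1 / 2) powr - \<alpha> = 2 powr \<alpha> / (2 * real k + 1) powr \<alpha>"
proof -
  have "(real k + 1 / 2) = (2 * real k + 1) / 2" by simp
  then show ?thesis by (simp add: powr_divide powr_minus field_simps)
qed

text \<open>The power of \<open>n\<close> and the sum over odd numbers in \<open>W_corr\<close> are
  exactly minus the partial sum of the defects, and the two zeta terms combine to the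
  constant.\<close>

lemma W_corr_eq:
  assumes "0 < \<alpha>" "\<alpha> < 1"
  shows "W_corr \<alpha> n = - ((2 powr \<alpha> - 1) * zeta_real \<alpha>) - (\<Sum>k<n. midpoint_defect \<alpha> k)"
proof -
  have "(\<Sum>k=1..n. 1 / (2 * real k - 1) powr \<alpha>) = (\<Sum>k<n. 1 / (2 * real k + 1) powr \<alpha>)"
    by (rule sum.reindex_bij_witness[of _ "\<lambda>k. k + 1" "\<lambda>k. k - 1"]) auto
  then show ?thesis
    by (simp add: W_corr_def sum_midpoint_defect[OF assms] powr_minus_add_half algebra_simps sum_distrib_left)
qed

lemma sum_even_odd:
  fixes f :: "nat \<Rightarrow> 'a::comm_monoid_add"
  shows "(\<Sum>k<2 * n. f k) = (\<Sum>k<n. f (2 * k)) + (\<Sum>k<n. f (2 * k + 1))"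
  by (induction n) (auto simp: ac_simps)

text \<open>Splitting the first \<open>2 * n\<close> integers into odd and even ones writes
  \<open>W_corr\<close> through the regularised sums \<open>A (2 * n)\<close> and
  \<open>A n\<close>, both of which converge to zeta. By \<open>W_corr_eq\<close> this evaluates the
  sum of all defects as \<open>- ((2 powr \<alpha> - 1) * zeta_real \<alpha>)\<close>.\<close>

lemma W_corr_tendsto_0:
  assumes "0 < \<alpha>" "\<alpha> < 1"
  shows "(\<lambda>n. W_corr \<alpha> n) \<longlonglongrightarrow> 0"
proof -
  define A where "A = (\<lambda>N. (\<Sum>k<N. real (Suc k) powr - \<alpha>) - real N powr (1 - \<alpha>) / (1 - \<alpha>))"
  have A: "A \<longlonglongrightarrow> zeta_real \<alpha>" unfolding A_def by (rule zeta_real_tendsto[OF assms])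
  then have A2: "(\<lambda>n. A (2 * n)) \<longlonglongrightarrow> zeta_real \<alpha>"
    by (rule filterlim_compose) (rule filterlim_subseq, simp add: strict_mono_def)
  have eq: "W_corr \<alpha> n = 2 powr \<alpha> * A (2 * n) - A n - (2 powr \<alpha> - 1) * zeta_real \<alpha>" for n
  proof -
    \<comment> \<open>The summation index starts at 0, so an odd index \<open>2 * k + 1\<close>
      belongs to the even integer \<open>2 * (k + 1)\<close>; the even indices give the
      half-integers in \<open>**\<close>.\<close>
    have *: "2 powr \<alpha> * real (Suc (2 * k + 1)) powr - \<alpha> = real (Suc k) powr - \<alpha>" for k
    proof -
      have "real (Suc (2 * k + 1)) = 2 * real (Suc k)" by simp
      then show ?thesis by (simp add: powr_mult powr_minus del: of_nat_Suc)
    qed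
    have **: "2 powr \<alpha> * real (Suc (2 * k)) powr - \<alpha> = (real k + 1 / 2) powr - \<alpha>" for k
      unfolding powr_minus_add_half by (simp add: powr_minus divide_inverse add.commute)
    have "2 powr \<alpha> * (\<Sum>k<2*n. real (Suc k) powr - \<alpha>)
        = (\<Sum>k<n. (real k + 1 / 2) powr - \<alpha>) + (\<Sum>k<n. real (Suc k) powr - \<alpha>)"
      unfolding sum_even_odd distrib_left sum_distrib_left * ** ..
    \<comment> \<open>Subtracting the boundary term of \<open>A n\<close> leaves a single
      \<open>real n powr (1 - \<alpha>)\<close>, as in \<open>sum_midpoint_defect\<close>.\<close>
    moreover have "2 powr \<alpha> * real (2 * n) powr (1 - \<alpha>) = 2 * real n powr (1 - \<alpha>)"
      by (simp add: powr_mult powr_diff)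
    ultimately show ?thesis
      unfolding W_corr_eq[OF assms] sum_midpoint_defect[OF assms] A_def
      by (simp add: right_diff_distrib del: of_nat_Suc of_nat_mult)
  qed
  have "(\<lambda>n. W_corr \<alpha> n) \<longlonglongrightarrow> 2 powr \<alpha> * zeta_real \<alpha> - zeta_real \<alpha> - (2 powr \<alpha> - 1) * zeta_real \<alpha>"
    unfolding eq by (intro tendsto_intros A A2)
  then show ?thesis by (simp add: algebra_simps)
qed

text \<open>Since \<open>W_corr\<close> tends to 0, it is the sum of the defects with index at least
  \<open>n\<close>, where \<open>n\<close> is below the weight \<open>k + 1\<close>. The estimate is
  made for the finite piece from \<open>n\<close> to \<open>N\<close> and passed to the limit in
  \<open>N\<close>.\<close>

lemma W_corr_bound:
  assumes "0 < \<alpha>" "\<alpha> < 1"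
  shows "real n * \<bar>W_corr \<alpha> n\<bar> \<le> (\<Sum>k. (real k + 1) * \<bar>midpoint_defect \<alpha> k\<bar>)"
proof -
  define K where "K = (\<Sum>k. (real k + 1) * \<bar>midpoint_defect \<alpha> k\<bar>)"
  have lim: "(\<lambda>N. real n * \<bar>W_corr \<alpha> n - W_corr \<alpha> N\<bar>) \<longlonglongrightarrow> real n * \<bar>W_corr \<alpha> n - 0\<bar>"
    by (intro tendsto_intros W_corr_tendsto_0[OF assms])
  have "real n * \<bar>W_corr \<alpha> n - W_corr \<alpha> N\<bar> \<le> K" if N: "n \<le> N" for N
  proof -
    have "W_corr \<alpha> n - W_corr \<alpha> N = (\<Sum>k=n..<N. midpoint_defect \<alpha> k)"
      using sum.atLeastLessThan_concat[of 0 n N "midpoint_defect \<alpha>"] N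
      by (simp add: W_corr_eq[OF assms] atLeast0LessThan)
    then have "real n * \<bar>W_corr \<alpha> n - W_corr \<alpha> N\<bar> \<le> real n * (\<Sum>k=n..<N. \<bar>midpoint_defect \<alpha> k\<bar>)"
      by (simp add: mult_left_mono sum_abs)
    also have "\<dots> \<le> (\<Sum>k=n..<N. (real k + 1) * \<bar>midpoint_defect \<alpha> k\<bar>)"
      unfolding sum_distrib_left by (intro sum_mono mult_right_mono) auto
    also have "\<dots> \<le> K"
      unfolding K_def by (intro sum_le_suminf summable_midpoint_defect assms) auto
    finally show ?thesis .
  qed
  then have "real n * \<bar>W_corr \<alpha> n - 0\<bar> \<le> K"
    by (intro tendsto_upperbound[OF lim]) (auto simp: eventually_sequentially)
  then show ?thesis by (simp add: K_def)
qed

section \<open>Error of the corrected midpoint rule\<close>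

lemma has_integral_powr_minus:
  fixes a b :: real
  assumes "0 < \<alpha>" "\<alpha> < 1" "0 \<le> a" "a \<le> b"
  shows "((\<lambda>x. x powr - \<alpha>) has_integral (b powr (1 - \<alpha>) - a powr (1 - \<alpha>)) / (1 - \<alpha>)) {a..b}"
proof -
  define F where "F = (\<lambda>x::real. x powr (1 - \<alpha>) / (1 - \<alpha>))"
  have "((\<lambda>x. x powr - \<alpha>) has_integral F b - F a) {a..b}"
  \<comment> \<open>The left end may be 0, where \<open>F\<close> is continuous but has no finite
    derivative; differentiability is asked for only inside the interval.\<close>
  proof (rule fundamental_theorem_of_calculus_interior[OF assms(4)])
    show "continuous_on {a..b} F"
      unfolding F_def using assms by (intro continuous_on_divide continuous_on_powr' continuous_intros) auto
    fix x assume "x \<in> {a<..<b}"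
    then have "0 < x" using assms by simp
    then have "(F has_real_derivative (1 - \<alpha>) * x powr (1 - \<alpha> - 1) / (1 - \<alpha>)) (at x)"
      unfolding F_def by (intro DERIV_cdivide has_real_derivative_powr)
    then show "(F has_vector_derivative x powr - \<alpha>) (at x)"
      using assms by (simp add: has_real_derivative_iff_has_vector_derivative)
  qed
  then show ?thesis by (simp add: F_def diff_divide_distrib)
qed

lemma integrable_powr_minus_mult:
  fixes g :: "real \<Rightarrow> real"
  assumes "0 < \<alpha>" "\<alpha> < 1" "0 \<le> a" "a \<le> b" "continuous_on {a..b} g"
  shows "(\<lambda>x. x powr - \<alpha> * g x) integrable_on {a..b}"
proof -
  have "(\<lambda>x. x powr - \<alpha>) absolutely_integrable_on {a..b}"
    using has_integral_powr_minus[OF assms(1-4)]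
    by (intro nonnegative_absolutely_integrable_1) auto
  moreover have "g \<in> borel_measurable (lebesgue_on {a..b})"
    by (intro continuous_imp_measurable_on_sets_lebesgue assms) auto
  moreover have "bounded (g ` {a..b})"
    by (intro compact_imp_bounded compact_continuous_image assms) auto
  ultimately have "(\<lambda>x. g x * x powr - \<alpha>) absolutely_integrable_on {a..b}"
    by (intro absolutely_integrable_bounded_measurable_product_real) auto
  then show ?thesis
    by (simp add: absolutely_integrable_on_def mult.commute)
qed

text \<open>For \<open>k > 0\<close>, the maximum minus the minimum of the decreasing weight on the
  cell. The weight is unbounded on cell 0, where the integral of the weight plus its midpoint value
  is used instead.\<close>

definition oscillation_bound :: "real \<Rightarrow> nat \<Rightarrow> real" where
  "oscillation_bound \<alpha> k =
     (if k = 0 then 1 / (1 - \<alpha>) + 2 powr \<alpha> else real k powr - \<alpha> - (real k + 1) powr - \<alpha>)"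

text \<open>From \<open>k = 1\<close> on the sum telescopes to less than 1, uniformly in
  \<open>n\<close>; the other two terms come from cell 0.\<close>

lemma sum_oscillation_bound:
  assumes "0 < \<alpha>"
  shows "(\<Sum>k<n. oscillation_bound \<alpha> k) \<le> \<bar>1 / (1 - \<alpha>)\<bar> + 2 powr \<alpha> + 1"
proof (cases n)
  case (Suc m)
  have "(\<Sum>k<Suc m. oscillation_bound \<alpha> k) = 1 / (1 - \<alpha>) + 2 powr \<alpha> + 1 - (real m + 1) powr - \<alpha>"
    by (induction m) (auto simp: oscillation_bound_def add.commute)
  moreover have "1 / (1 - \<alpha>) \<le> \<bar>1 / (1 - \<alpha>)\<bar>" by (rule abs_ge_self)
  ultimately show ?thesis using Suc by (smt (verit) powr_ge_zero)
qed simp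

text \<open>With \<open>p s = s powr - \<alpha>\<close>, the error is the integral of
  \<open>(p s - p m) * (g s - g m)\<close> over a cell of length 1: the terms
  \<open>p m * g s\<close> give the exact increment of \<open>u\<close>, and those with
  \<open>g m\<close> give the midpoint defect. The second factor is at most \<open>L\<close>, and
  the first integrates to at most the oscillation bound.\<close>

lemma cell_error:
  fixes u g :: "real \<Rightarrow> real" and k :: nat
  defines "I \<equiv> {real k..real k + 1}" and "m \<equiv> real k + 1 / 2"
  assumes \<alpha>: "0 < \<alpha>" "\<alpha> < 1"
    and u: "\<And>s. s \<in> I \<Longrightarrow> (u has_real_derivative g s) (at s within I)"
    and lip: "\<And>r s. r \<in> I \<Longrightarrow> s \<in> I \<Longrightarrow> \<bar>g r - g s\<bar> \<le> L * \<bar>r - s\<bar>"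
  shows "(\<lambda>s. s powr - \<alpha> * g s) integrable_on I"
    and "\<bar>integral I (\<lambda>s. s powr - \<alpha> * g s) - m powr - \<alpha> * (u (real k + 1) - u (real k))
            - g m * midpoint_defect \<alpha> k\<bar> \<le> L * oscillation_bound \<alpha> k"
proof -
  define p where "p = (\<lambda>s::real. s powr - \<alpha>)"
  have mI: "m \<in> I" by (simp add: I_def m_def)
  have "\<bar>g (real k) - g (real k + 1)\<bar> \<le> L * \<bar>real k - (real k + 1)\<bar>" by (rule lip) (auto simp: I_def)
  then have L: "0 \<le> L" by simp
  have "continuous_on I g"
  proof (rule continuous_on_iff[THEN iffD2], intro ballI allI impI)
    fix x e :: real assume x: "x \<in> I" "0 < e"
    \<comment> \<open>\<open>L + 1\<close> instead of \<open>L\<close> keeps the radius defined when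
      \<open>L\<close> is 0.\<close>
    have "\<bar>g y - g x\<bar> < e" if "y \<in> I" "\<bar>y - x\<bar> < e / (L + 1)" for y
    proof -
      have "\<bar>g y - g x\<bar> \<le> (L + 1) * \<bar>y - x\<bar>"
        using lip[OF that(1) x(1)] by (simp add: algebra_simps)
      also have "\<dots> < e" using that(2) L by (simp add: field_simps)
      finally show ?thesis .
    qed
    then show "\<exists>d>0. \<forall>y\<in>I. dist y x < d \<longrightarrow> dist (g y) (g x) < e"
      using x L by (intro exI[of _ "e / (L + 1)"]) (auto simp: dist_real_def)
  qed
  then show int: "(\<lambda>s. s powr - \<alpha> * g s) integrable_on I"
    unfolding I_def using \<alpha> by (intro integrable_powr_minus_mult) auto
  define J where "J = integral I (\<lambda>s. s powr - \<alpha> * g s)"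
  define P where "P = ((real k + 1) powr (1 - \<alpha>) - real k powr (1 - \<alpha>)) / (1 - \<alpha>)"
  have J: "((\<lambda>s. p s * g s) has_integral J) I"
    unfolding J_def p_def using int by (rule integrable_integral)
  have P: "(p has_integral P) I"
    unfolding p_def P_def I_def using \<alpha> by (intro has_integral_powr_minus) auto
  have G: "(g has_integral u (real k + 1) - u (real k)) I"
    unfolding I_def using u
    by (intro fundamental_theorem_of_calculus)
       (auto simp: I_def has_real_derivative_iff_has_vector_derivative)
  have one: "((\<lambda>s. p m * g m) has_integral p m * g m) I"
    unfolding I_def using has_integral_const_real[of "p m * g m" "real k" "real k + 1"] by simp
  have D: "((\<lambda>s. p s * g s - p m * g s - g m * p s + p m * g m) has_integral
      J - p m * (u (real k + 1) - u (real k)) - g m * P + p m * g m) I"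
    by (intro has_integral_add has_integral_diff has_integral_mult_right J P G one)
  have eq: "J - p m * (u (real k + 1) - u (real k)) - g m * P + p m * g m
     = J - p m * (u (real k + 1) - u (real k)) - g m * midpoint_defect \<alpha> k"
    by (simp add: midpoint_defect_def P_def p_def m_def algebra_simps)
  \<comment> \<open>An integrable majorant of \<open>p s - p m\<close>: the sum of both values in
    the singular cell, a constant in all others.\<close>
  obtain b where b: "(b has_integral oscillation_bound \<alpha> k) I" "\<And>s. s \<in> I \<Longrightarrow> \<bar>p s - p m\<bar> \<le> b s"
  proof (cases "k = 0")
    case True
    have "((\<lambda>s. p s + p m) has_integral P + p m) I"
      using has_integral_const_real[of "p m" "real k" "real k + 1"] unfolding I_def
      by (intro has_integral_add P[unfolded I_def]) auto
    moreover have "P + p m = oscillation_bound \<alpha> k"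
      using True by (simp add: P_def p_def m_def oscillation_bound_def powr_minus powr_divide)
    moreover have "\<bar>p s - p m\<bar> \<le> p s + p m" for s
      using powr_ge_zero[of s "-\<alpha>"] powr_ge_zero[of m "-\<alpha>"] unfolding p_def by linarith
    ultimately show ?thesis using that[of "\<lambda>s. p s + p m"] by simp
  next
    case False
    have "((\<lambda>s. oscillation_bound \<alpha> k) has_integral oscillation_bound \<alpha> k) I"
      unfolding I_def using has_integral_const_real[of "oscillation_bound \<alpha> k" "real k" "real k + 1"] by simp
    moreover have *: "(real k + 1) powr - \<alpha> \<le> p s \<and> p s \<le> real k powr - \<alpha>" if "s \<in> I" for s
      using that False \<alpha> unfolding p_def I_def by (intro conjI powr_mono2') auto
    have "\<bar>p s - p m\<bar> \<le> oscillation_bound \<alpha> k" if "s \<in> I" for s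
    proof -
      have "oscillation_bound \<alpha> k = real k powr - \<alpha> - (real k + 1) powr - \<alpha>"
        using False by (simp add: oscillation_bound_def)
      then show ?thesis using *[OF that] *[OF mI] by linarith
    qed
    ultimately show ?thesis by (intro that[of "\<lambda>s. oscillation_bound \<alpha> k"])
  qed
  have "norm (integral I (\<lambda>s. p s * g s - p m * g s - g m * p s + p m * g m)) \<le> integral I (\<lambda>s. L * b s)"
  proof (rule integral_norm_bound_integral)
    show "(\<lambda>s. L * b s) integrable_on I"
      using has_integral_mult_right[OF b(1), of L] by (rule has_integral_integrable)
    fix s assume s: "s \<in> I"
    have "\<bar>g s - g m\<bar> \<le> L * \<bar>s - m\<bar>" by (rule lip[OF s mI])
    also have "\<dots> \<le> L * 1" using s mI L by (intro mult_left_mono) (auto simp: I_def m_def)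
    finally have "\<bar>p s - p m\<bar> * \<bar>g s - g m\<bar> \<le> b s * L"
      using b(2)[OF s] by (intro mult_mono) auto
    then show "norm (p s * g s - p m * g s - g m * p s + p m * g m) \<le> L * b s"
      by (simp add: abs_mult[symmetric] algebra_simps)
  qed (use D in blast)
  also have "integral I (\<lambda>s. L * b s) = L * oscillation_bound \<alpha> k"
    using has_integral_mult_right[OF b(1), of L] by (rule integral_unique)
  finally show "\<bar>integral I (\<lambda>s. s powr - \<alpha> * g s) - m powr - \<alpha> * (u (real k + 1) - u (real k))
            - g m * midpoint_defect \<alpha> k\<bar> \<le> L * oscillation_bound \<alpha> k"
    unfolding integral_unique[OF D] eq by (simp add: J_def p_def)
qed

lemma has_integral_sum_cells:
  fixes f :: "real \<Rightarrow> real"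
  assumes "\<And>k. k < n \<Longrightarrow> (f has_integral c k) {real k..real k + 1}"
  shows "(f has_integral (\<Sum>k<n. c k)) {0..real n}"
  using assms
proof (induction n)
  case (Suc n)
  have "(f has_integral (\<Sum>k<n. c k) + c n) {0..real n + 1}"
    by (rule has_integral_combine[of _ "real n"]) (use Suc in auto)
  then show ?case by (simp add: add.commute)
qed (simp add: has_integral_refl)

text \<open>The multiples of \<open>g 0\<close> cancel because the defects add up to
  \<open>- Z - W_corr \<alpha> n\<close>. What remains is controlled by deviations of
  \<open>g\<close> from \<open>g 0\<close>, hence by \<open>L\<close> times a factor free of
  \<open>n\<close>. One \<open>K\<close> pays for the cells, the other for the correction at the far
  end.\<close>

lemma corrected_midpoint_error:
  fixes u g :: "real \<Rightarrow> real" and n :: nat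
  assumes \<alpha>: "0 < \<alpha>" "\<alpha> < 1" and n: "1 \<le> n"
    and u: "\<And>s. s \<in> {0..real n} \<Longrightarrow> (u has_real_derivative g s) (at s within {0..real n})"
    and lip: "\<And>r s. r \<in> {0..real n} \<Longrightarrow> s \<in> {0..real n} \<Longrightarrow> \<bar>g r - g s\<bar> \<le> L * \<bar>r - s\<bar>"
  defines "Z \<equiv> (2 powr \<alpha> - 1) * zeta_real \<alpha>"
  defines "K \<equiv> (\<Sum>k. (real k + 1) * \<bar>midpoint_defect \<alpha> k\<bar>)"
  shows "\<exists>J. ((\<lambda>s. s powr - \<alpha> * g s) has_integral J) {0..real n} \<and>
     \<bar>(\<Sum>k<n. (real k + 1 / 2) powr - \<alpha> * (u (real k + 1) - u (real k)))
        - Z * (u 1 - u 0) - W_corr \<alpha> n * (u (real n) - u (real n - 1)) - J\<bar>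
      \<le> L * (\<bar>1 / (1 - \<alpha>)\<bar> + 2 powr \<alpha> + 1 + 2 * K + \<bar>Z\<bar>)"
proof -
  define I where "I = (\<lambda>k::nat. {real k..real k + 1})"
  define c where "c = (\<lambda>k. integral (I k) (\<lambda>s. s powr - \<alpha> * g s))"
  define \<Delta> where "\<Delta> = (\<lambda>k::nat. u (real k + 1) - u (real k))"
  define m where "m = (\<lambda>k::nat. real k + 1 / 2)"
  define e where "e = midpoint_defect \<alpha>"
  define W where "W = W_corr \<alpha> n"
  have sub: "I k \<subseteq> {0..real n}" if "k < n" for k
    using that by (auto simp: I_def)
  have uI: "(u has_real_derivative g s) (at s within I k)" if "k < n" "s \<in> I k" for k s
    using DERIV_subset[OF u sub[OF that(1)]] sub that by blast
  have lipI: "\<bar>g r - g s\<bar> \<le> L * \<bar>r - s\<bar>" if "k < n" "r \<in> I k" "s \<in> I k" for k r s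
    using lip sub that by blast
  have "\<bar>g 0 - g 1\<bar> \<le> L * \<bar>0 - 1\<bar>" using n by (intro lip) auto
  then have L: "0 \<le> L" by simp
  have J: "((\<lambda>s. s powr - \<alpha> * g s) has_integral (\<Sum>k<n. c k)) {0..real n}"
  proof (rule has_integral_sum_cells)
    fix k assume k: "k < n"
    have "(\<lambda>s. s powr - \<alpha> * g s) integrable_on {real k..real k + 1}"
      by (rule cell_error(1)[OF \<alpha>, where u = u and L = L]) (use uI[OF k] lipI[OF k] in \<open>auto simp: I_def\<close>)
    then show "((\<lambda>s. s powr - \<alpha> * g s) has_integral c k) {real k..real k + 1}"
      unfolding c_def I_def by (rule integrable_integral)
  qed
  \<comment> \<open>Replacing the midpoint value of \<open>g\<close> by \<open>g 0\<close> costs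
    \<open>L * (real k + 1)\<close> per unit of defect.\<close>
  have cell: "\<bar>c k - m k powr - \<alpha> * \<Delta> k - g 0 * e k\<bar> \<le> L * oscillation_bound \<alpha> k + L * ((real k + 1) * \<bar>e k\<bar>)"
    if k: "k < n" for k
  proof -
    have A: "\<bar>c k - m k powr - \<alpha> * \<Delta> k - g (m k) * e k\<bar> \<le> L * oscillation_bound \<alpha> k"
      unfolding c_def I_def m_def \<Delta>_def e_def
      by (rule cell_error(2)[OF \<alpha>]) (use uI[OF k] lipI[OF k] in \<open>auto simp: I_def\<close>)
    have "\<bar>g (m k) - g 0\<bar> \<le> L * \<bar>m k - 0\<bar>" using k by (intro lip) (auto simp: m_def)
    also have "\<dots> \<le> L * (real k + 1)" using L by (intro mult_left_mono) (auto simp: m_def)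
    finally have "\<bar>(g (m k) - g 0) * e k\<bar> \<le> L * (real k + 1) * \<bar>e k\<bar>"
      unfolding abs_mult by (intro mult_right_mono) auto
    moreover have "c k - m k powr - \<alpha> * \<Delta> k - g 0 * e k
      = (c k - m k powr - \<alpha> * \<Delta> k - g (m k) * e k) + (g (m k) - g 0) * e k"
      by (simp add: algebra_simps)
    ultimately show ?thesis using A by (simp add: mult.assoc)
  qed
  \<comment> \<open>Each increment of \<open>u\<close> is a value of \<open>g\<close> in the cell,
    at distance below \<open>k + 1\<close> from 0.\<close>
  have diff: "\<bar>\<Delta> k - g 0\<bar> \<le> L * (real k + 1)" if k: "k < n" for k
  proof -
    have "\<exists>x\<in>{real k<..<real k + 1}. u (real k + 1) - u (real k) = g x * (real k + 1 - real k)"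
      by (rule mvt_simple)
         (use uI[OF k] in \<open>auto simp: I_def intro: has_field_derivative_imp_has_derivative\<close>)
    then obtain x where x: "real k < x" "x < real k + 1" "\<Delta> k = g x"
      by (auto simp: \<Delta>_def)
    have "\<bar>g x - g 0\<bar> \<le> L * \<bar>x - 0\<bar>" using x k by (intro lip) auto
    also have "\<dots> \<le> L * (real k + 1)" using L x by (intro mult_left_mono) auto
    finally show ?thesis by (simp add: x)
  qed
  have "\<bar>\<Sum>k<n. c k - m k powr - \<alpha> * \<Delta> k - g 0 * e k\<bar>
      \<le> (\<Sum>k<n. L * oscillation_bound \<alpha> k + L * ((real k + 1) * \<bar>e k\<bar>))"
    using cell by (intro order_trans[OF sum_abs sum_mono]) auto
  also have "\<dots> = L * (\<Sum>k<n. oscillation_bound \<alpha> k) + L * (\<Sum>k<n. (real k + 1) * \<bar>e k\<bar>)"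
    by (simp add: sum.distrib sum_distrib_left)
  also have "\<dots> \<le> L * (\<bar>1 / (1 - \<alpha>)\<bar> + 2 powr \<alpha> + 1) + L * K"
    unfolding K_def e_def using L \<alpha>
    by (intro add_mono mult_left_mono sum_oscillation_bound sum_le_suminf summable_midpoint_defect) auto
  finally have cells: "\<bar>\<Sum>k<n. c k - m k powr - \<alpha> * \<Delta> k - g 0 * e k\<bar> \<le> \<dots>" .
  have first: "\<bar>Z * (\<Delta> 0 - g 0)\<bar> \<le> \<bar>Z\<bar> * L"
    unfolding abs_mult using diff[of 0] n by (intro mult_left_mono) auto
  \<comment> \<open>In the last cell the deviation grows like \<open>n\<close>; the decay of
    \<open>W_corr\<close> absorbs it.\<close>
  have "\<bar>W * (\<Delta> (n - 1) - g 0)\<bar> \<le> \<bar>W\<bar> * (L * real n)"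
    unfolding abs_mult using diff[of "n - 1"] n by (intro mult_left_mono) (auto simp: of_nat_diff)
  also have "\<dots> = L * (real n * \<bar>W\<bar>)" by simp
  also have "\<dots> \<le> L * K" unfolding W_def K_def by (intro mult_left_mono W_corr_bound \<alpha> L)
  finally have last: "\<bar>W * (\<Delta> (n - 1) - g 0)\<bar> \<le> L * K" .
  have "(\<Sum>k<n. e k) = - Z - W"
    unfolding e_def W_def Z_def by (simp add: W_corr_eq[OF \<alpha>])
  then have "(\<Sum>k<n. c k - m k powr - \<alpha> * \<Delta> k - g 0 * e k)
      = (\<Sum>k<n. c k) - (\<Sum>k<n. m k powr - \<alpha> * \<Delta> k) - g 0 * (- Z - W)"
    by (simp add: sum_subtractf flip: sum_distrib_left)
  then have "(\<Sum>k<n. m k powr - \<alpha> * \<Delta> k) - Z * \<Delta> 0 - W * \<Delta> (n - 1) - (\<Sum>k<n. c k)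
      = - (\<Sum>k<n. c k - m k powr - \<alpha> * \<Delta> k - g 0 * e k) - Z * (\<Delta> 0 - g 0) - W * (\<Delta> (n - 1) - g 0)"
    by (simp add: algebra_simps)
  also have "\<bar>\<dots>\<bar> \<le> L * (\<bar>1 / (1 - \<alpha>)\<bar> + 2 powr \<alpha> + 1) + L * K + \<bar>Z\<bar> * L + L * K"
    using cells first last by linarith
  also have "\<dots> = L * (\<bar>1 / (1 - \<alpha>)\<bar> + 2 powr \<alpha> + 1 + 2 * K + \<bar>Z\<bar>)"
    by (simp add: algebra_simps)
  finally show ?thesis
    using J n by (intro exI[of _ "\<Sum>k<n. c k"]) (simp add: m_def \<Delta>_def W_def of_nat_diff)
qed

section \<open>The scheme as a corrected midpoint rule, by summation by parts\<close>

lemma sum_caputo_weight: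
  fixes Y :: "nat \<Rightarrow> real"
  assumes n: "3 \<le> n"
  shows "(\<Sum>k=0..n. caputo_weight \<alpha> n k * Y k)
    = (\<Sum>k<n. (real k + 1 / 2) powr - \<alpha> * (Y k - Y (Suc k)))
      - (2 powr \<alpha> - 1) * zeta_real \<alpha> * (Y 0 - Y 1) - W_corr \<alpha> n * (Y (n - 1) - Y n)"
proof -
  define c where "c = (\<lambda>k::nat. (real k + 1 / 2) powr - \<alpha>)"
  \<comment> \<open>Apart from the corrections, the weight is \<open>c k - c (k - 1)\<close>, with
    the first part cut off at \<open>k = n\<close> and the second at \<open>k = 0\<close>. The
    corrections are point masses at 0, 1, \<open>n - 1\<close> and \<open>n\<close>.\<close>
  define a where "a = (\<lambda>k. if k < n then c k else 0)"
  define b where "b = (\<lambda>k::nat. if 0 < k then c (k - 1) else 0)"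
  define Z where "Z = (2 powr \<alpha> - 1) * zeta_real \<alpha>"
  have cw: "caputo_weight \<alpha> n k = a k - b k - Z * (if 0 = k then 1 else 0) + Z * (if 1 = k then 1 else 0)
      - W_corr \<alpha> n * (if n - 1 = k then 1 else 0) + W_corr \<alpha> n * (if n = k then 1 else 0)"
    if k: "k \<le> n" for k
  proof -
    \<comment> \<open>From \<open>n = 3\<close> on the four end indices are distinct, so at most one
      mass acts in each case.\<close>
    consider "k = 0" | "k = 1" | "2 \<le> k" "k \<le> n - 2" | "2 \<le> k" "k = n - 1" | "k = n" "2 \<le> k"
      using k n by linarith
    moreover obtain j where "n = j + 3" using n by (metis add.commute le_Suc_ex)
    ultimately show ?thesis
      by cases
        (simp_all add: caputo_weight_def a_def b_def c_def Z_def powr_minus_add_half of_nat_diff powr_divide right_diff_distrib)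
  qed
  have A: "(\<Sum>k\<le>n. a k * Y k) = (\<Sum>k<n. c k * Y k)"
    by (simp add: a_def flip: lessThan_Suc_atMost)
  obtain n' where n': "n = Suc n'" using n by (cases n) auto
  have B: "(\<Sum>k\<le>n. b k * Y k) = (\<Sum>k<n. c k * Y (Suc k))"
    unfolding n' sum.atMost_Suc_shift by (simp add: b_def lessThan_Suc_atMost)
  have delta: "(\<Sum>k\<le>n. v * (if j = k then 1 else 0) * Y k) = v * Y j" if "j \<le> n" for v j
    using that by (simp add: if_distrib[of "\<lambda>x. v * x * _"] sum.delta' cong: if_cong)
  have "(\<Sum>k=0..n. caputo_weight \<alpha> n k * Y k) = (\<Sum>k\<le>n. a k * Y k - b k * Y k
      - Z * (if 0 = k then 1 else 0) * Y k + Z * (if 1 = k then 1 else 0) * Y k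
      - W_corr \<alpha> n * (if n - 1 = k then 1 else 0) * Y k + W_corr \<alpha> n * (if n = k then 1 else 0) * Y k)"
    by (intro sum.cong) (auto simp: cw ring_distribs)
  also have "\<dots> = (\<Sum>k<n. c k * Y k) - (\<Sum>k<n. c k * Y (Suc k)) - Z * Y 0 + Z * Y 1
      - W_corr \<alpha> n * Y (n - 1) + W_corr \<alpha> n * Y n"
    unfolding sum.distrib sum_subtractf using n by (subst delta; simp only: A B)+
  finally show ?thesis
    by (simp add: c_def Z_def sum_subtractf right_diff_distrib)
qed

section \<open>From the rescaled quadrature error to the Caputo derivative\<close>

lemma C2_on_imp_Lipschitz_deriv:
  fixes y :: "real \<Rightarrow> real"
  assumes "C2_on {a..b} y"
  obtains y' M where "\<And>x. x \<in> {a..b} \<Longrightarrow> (y has_real_derivative y' x) (at x within {a..b})"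
    and "\<And>r s. r \<in> {a..b} \<Longrightarrow> s \<in> {a..b} \<Longrightarrow> \<bar>y' r - y' s\<bar> \<le> M * \<bar>r - s\<bar>" and "0 \<le> M"
proof -
  obtain y' y'' where y: "\<forall>x\<in>{a..b}. (y has_real_derivative y' x) (at x within {a..b})"
    "\<forall>x\<in>{a..b}. (y' has_real_derivative y'' x) (at x within {a..b})" "continuous_on {a..b} y''"
    using assms unfolding C2_on_def by blast
  have "bounded (y'' ` {a..b})"
    by (intro compact_imp_bounded compact_continuous_image y) auto
  then obtain M where M: "0 < M" "\<And>x. x \<in> {a..b} \<Longrightarrow> norm (y'' x) \<le> M"
    unfolding bounded_pos by blast
  have "norm (y' r - y' s) \<le> M * norm (r - s)" if "r \<in> {a..b}" "s \<in> {a..b}" for r s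
    by (rule field_differentiable_bound[where f' = y'' and S = "{a..b}"]) (use y M that in auto)
  with y(1) M(1) show ?thesis by (intro that[of y' M]) auto
qed

lemma caputo_deriv_rescale:
  fixes y y' :: "real \<Rightarrow> real" and n :: nat
  assumes t: "0 < t" and n: "0 < n"
    and y': "\<And>x. x \<in> {0..t} \<Longrightarrow> (y has_real_derivative y' x) (at x within {0..t})"
  defines "h \<equiv> t / real n"
  assumes J: "((\<lambda>s. s powr - \<alpha> * y' (t - h * s)) has_integral J) {0..real n}"
  shows "caputo_deriv \<alpha> y t = 1 / (Gamma (1 - \<alpha>) * h powr \<alpha>) * (h * J)"
proof -
  have h: "0 < h" "h * real n = t" using t n by (auto simp: h_def)
  define F where "F = (\<lambda>s. s powr - \<alpha> * y' (t - h * s))"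
  define v where "v = (\<lambda>x. vector_derivative y (at x within {0..t}) / (t - x) powr \<alpha>)"
  \<comment> \<open>The affine substitution rule returns its domain as an image under the inverse
    map, here \<open>s\<close> to \<open>t - h * s\<close>.\<close>
  have img: "(\<lambda>x. (1 / (- 1 / h)) *\<^sub>R x + - ((1 / (- 1 / h)) *\<^sub>R (t / h))) ` cbox 0 (real n) = {0..t}"
  proof -
    have eq: "(\<lambda>x. (1 / (- 1 / h)) *\<^sub>R x + - ((1 / (- 1 / h)) *\<^sub>R (t / h))) = (\<lambda>x. (- h) * x + t)"
      using h by auto
    then show ?thesis unfolding eq box_real image_affinity_atLeastAtMost using h n by simp
  qed
  have "((\<lambda>x. F ((- 1 / h) *\<^sub>R x + t / h)) has_integral (1 / \<bar>- 1 / h\<bar> ^ DIM(real)) *\<^sub>R J)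
     ((\<lambda>x. (1 / (- 1 / h)) *\<^sub>R x + - ((1 / (- 1 / h)) *\<^sub>R (t / h))) ` cbox 0 (real n))"
    using J h by (intro has_integral_affinity) (auto simp: F_def)
  then have "((\<lambda>x. F ((- 1 / h) *\<^sub>R x + t / h)) has_integral h * J) {0..t}"
    unfolding img using h by simp
  \<comment> \<open>This includes \<open>x = t\<close>: both sides are 0 there, by
    \<open>0 powr - \<alpha> = 0\<close> on the left and division by 0 on the right.\<close>
  moreover have "F ((- 1 / h) *\<^sub>R x + t / h) = h powr \<alpha> * v x" if x: "x \<in> {0..t}" for x
  proof -
    have "vector_derivative y (at x within {0..t}) = y' x"
      using y'[OF x] t x
      by (intro vector_derivative_within_closed_interval) (auto simp: has_real_derivative_iff_has_vector_derivative)
    moreover have "(- 1 / h) *\<^sub>R x + t / h = (t - x) / h" by (simp add: diff_divide_distrib)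
    moreover have "h * ((t - x) / h) = t - x" using h by simp
    ultimately show ?thesis
      using h x by (simp add: F_def v_def powr_divide powr_minus divide_simps)
  qed
  ultimately have "((\<lambda>x. h powr \<alpha> * v x) has_integral h * J) {0..t}"
    by (rule has_integral_eq[rotated])
  from integral_unique[OF this] have "h powr \<alpha> * integral {0..t} v = h * J"
    by simp
  then have "integral {0..t} v = h * J / h powr \<alpha>" using h by (simp add: field_simps)
  then show ?thesis by (simp add: caputo_deriv_def v_def[symmetric])
qed

theorem mainTheorem2:
  fixes \<alpha> t :: real and y :: "real \<Rightarrow> real"
  assumes "0 < \<alpha>" and "\<alpha> < 1" and "0 < t" and "C2_on {0..t} y"
  shows "(\<lambda>n::nat. let h = t / real n in
            1 / (Gamma (1 - \<alpha>) * h powr \<alpha>) * (\<Sum>k=0..n. caputo_weight \<alpha> n k * y (real (n - k) * h))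
            - caputo_deriv \<alpha> y t)
         \<in> O(\<lambda>n. (t / real n) powr (2 - \<alpha>))"
proof -
  obtain y' M where y': "\<And>x. x \<in> {0..t} \<Longrightarrow> (y has_real_derivative y' x) (at x within {0..t})"
    and M: "\<And>r s. r \<in> {0..t} \<Longrightarrow> s \<in> {0..t} \<Longrightarrow> \<bar>y' r - y' s\<bar> \<le> M * \<bar>r - s\<bar>" "0 \<le> M"
    using C2_on_imp_Lipschitz_deriv[OF assms(4)] by blast
  define \<Gamma> where "\<Gamma> = Gamma (1 - \<alpha>)"
  have \<Gamma>: "0 < \<Gamma>" unfolding \<Gamma>_def using assms by (intro Gamma_real_pos) auto
  \<comment> \<open>The factor from \<open>corrected_midpoint_error\<close>; it depends on
    \<open>\<alpha>\<close> alone.\<close>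
  define C where "C = \<bar>1 / (1 - \<alpha>)\<bar> + 2 powr \<alpha> + 1 + 2 * (\<Sum>k. (real k + 1) * \<bar>midpoint_defect \<alpha> k\<bar>)
     + \<bar>(2 powr \<alpha> - 1) * zeta_real \<alpha>\<bar>"
  show ?thesis
  proof (rule bigoI[where c = "M * C / \<Gamma>"], rule eventually_sequentiallyI[of 3])
    fix n :: nat assume n: "3 \<le> n"
    define h where "h = t / real n"
    have h: "0 < h" "h * real n = t" using assms n by (auto simp: h_def)
    have mem: "t - h * s \<in> {0..t}" if "s \<in> {0..real n}" for s
      using that h mult_left_mono[of s "real n" h] by auto
    \<comment> \<open>Normalised so that the derivative of \<open>u\<close> is
      \<open>y' (t - h * s)\<close>, the function \<open>g\<close> of the quadrature lemma. Then
      \<open>- h * u\<close> takes the samples of \<open>y\<close> counted back from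
      \<open>t\<close>.\<close>
    define u where "u = (\<lambda>s. - y (t - h * s) / h)"
    define Y where "Y = (\<lambda>k. y (real (n - k) * h))"
    define B where "B = (\<Sum>k<n. (real k + 1 / 2) powr - \<alpha> * (u (real k + 1) - u (real k)))
        - (2 powr \<alpha> - 1) * zeta_real \<alpha> * (u 1 - u 0) - W_corr \<alpha> n * (u (real n) - u (real n - 1))"
    have u': "(u has_real_derivative y' (t - h * s)) (at s within {0..real n})" if s: "s \<in> {0..real n}" for s
    proof -
      have "(y has_real_derivative y' (t - h * s)) (at (t - h * s) within (\<lambda>s. t - h * s) ` {0..real n})"
        using mem by (intro DERIV_subset[OF y'[OF mem[OF s]]]) auto
      moreover have "((\<lambda>s. t - h * s) has_real_derivative - h) (at s within {0..real n})"
        by (auto intro!: derivative_eq_intros)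
      ultimately have "((\<lambda>s. y (t - h * s)) has_real_derivative y' (t - h * s) * - h) (at s within {0..real n})"
        unfolding o_def[of y "\<lambda>s. t - h * s", symmetric] by (rule DERIV_image_chain)
      from DERIV_cdivide[OF DERIV_minus[OF this], of h] show ?thesis
        unfolding u_def using h by simp
    qed
    \<comment> \<open>Rescaling turns the Lipschitz constant \<open>M\<close> into
      \<open>M * h\<close>, one of the two powers of \<open>h\<close> in the rate.\<close>
    have lip: "\<bar>y' (t - h * r) - y' (t - h * s)\<bar> \<le> (M * h) * \<bar>r - s\<bar>"
      if "r \<in> {0..real n}" "s \<in> {0..real n}" for r s
    proof -
      have "\<bar>(t - h * r) - (t - h * s)\<bar> = h * \<bar>r - s\<bar>"
        using h by (simp add: abs_mult abs_minus_commute flip: right_diff_distrib)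
      then show ?thesis using M(1)[OF mem[OF that(1)] mem[OF that(2)]] by simp
    qed
    obtain J where J: "((\<lambda>s. s powr - \<alpha> * y' (t - h * s)) has_integral J) {0..real n}"
      "\<bar>B - J\<bar> \<le> (M * h) * C"
      unfolding B_def C_def using corrected_midpoint_error[OF assms(1,2) _ u' lip] n by fastforce
    have Y: "Y k = - h * u (real k)" if "k \<le> n" for k
    proof -
      have "real (n - k) * h = t - h * real k" using that h by (simp add: of_nat_diff algebra_simps)
      then show ?thesis using h by (simp add: Y_def u_def)
    qed
    have "(\<Sum>k=0..n. caputo_weight \<alpha> n k * Y k) = h * B"
    proof -
      have "(\<Sum>k<n. (real k + 1 / 2) powr - \<alpha> * (Y k - Y (Suc k)))
          = h * (\<Sum>k<n. (real k + 1 / 2) powr - \<alpha> * (u (real k + 1) - u (real k)))"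
        unfolding sum_distrib_left by (intro sum.cong) (auto simp: Y algebra_simps)
      moreover have "Y 0 - Y 1 = h * (u 1 - u 0)" "Y (n - 1) - Y n = h * (u (real n) - u (real n - 1))"
        using n by (auto simp: Y of_nat_diff algebra_simps)
      moreover have "h * S - z * (h * d) - w * (h * e) = h * (S - z * d - w * e)" for S z d w e
        by (simp add: algebra_simps)
      ultimately show ?thesis unfolding sum_caputo_weight[OF n] B_def by (simp only:)
    qed
    moreover have "caputo_deriv \<alpha> y t = 1 / (\<Gamma> * h powr \<alpha>) * (h * J)"
      unfolding \<Gamma>_def h_def using assms(3) n y' J(1) by (intro caputo_deriv_rescale[where y' = y']) (auto simp: h_def)
    ultimately have "1 / (\<Gamma> * h powr \<alpha>) * (\<Sum>k=0..n. caputo_weight \<alpha> n k * Y k) - caputo_deriv \<alpha> y t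
        = h / (\<Gamma> * h powr \<alpha>) * (B - J)"
      by (simp add: algebra_simps diff_divide_distrib)
    also have "\<bar>\<dots>\<bar> = h / (\<Gamma> * h powr \<alpha>) * \<bar>B - J\<bar>"
      using h \<Gamma> by (simp add: abs_mult)
    also have "\<dots> \<le> h / (\<Gamma> * h powr \<alpha>) * (M * h * C)"
      using h \<Gamma> J(2) by (intro mult_left_mono) auto
    \<comment> \<open>The other power of \<open>h\<close> comes from the substitution in the
      integral, and the prefactor removes \<open>h powr \<alpha>\<close>.\<close>
    also have "\<dots> = M * C / \<Gamma> * h powr (2 - \<alpha>)"
      using h by (simp add: powr_diff power2_eq_square)
    finally show "norm (let h = t / real n in
            1 / (Gamma (1 - \<alpha>) * h powr \<alpha>) * (\<Sum>k=0..n. caputo_weight \<alpha> n k * y (real (n - k) * h))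
            - caputo_deriv \<alpha> y t) \<le> M * C / \<Gamma> * norm ((t / real n) powr (2 - \<alpha>))"
      by (simp add: Let_def h_def Y_def \<Gamma>_def)
  qed
qed

end
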